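(* Let $n,k,m$ be positive integers. Suppose there exist matchings $V^{(0)},\dots,V^{(m-1)}$ in $Q_n$ such that each $V^{(j)}$ is a Breaker pairing strategy for $\mathcal{Q}(n,k)$ and $\bigcup_{j=0}^{m-1}V^{(j)}$ equals the set of all edges of $Q_n$. Suppose moreover that there is a partition of $E_n$ into $m$ sets, and a partition of $O_n$ into $m$ sets, such that every subcube of $Q_n$ of dimension $n-k+2$ contains at least one vertex from each of the sets in each partition. Then there exists a Breaker pairing strategy for $\mathcal{Q}(4n,b)$, where $b=\max\{4k-3,\,n+1\}$.
   Context: $Q_n$ is the hypercube graph on $\{0,1\}^n$ (vertices adjacent iff they differ in exactly one coordinate). $E_n$ denotes the set of vectors in $\{0,1\}^n$ with an even number of $1$'s and $O_n$ the set with an odd number of $1$'s. A $d$-dimensional subcube of $Q_n$ is obtained by choosing $n-d$ coordinates and fixed values in $\{0,1\}$ for them, and taking all $2^d$ vectors agreeing with these fixed values. $\mathcal{Q}(n,k)$ is the hypergraph with vertex set $\{0,1\}^n$ whose edges are the $k$-dimensional subcubes of $Q_n$ (the Maker–Breaker game is played on it). Following the paper's convention, a Breaker pairing strategy for $\mathcal{Q}(n,k)$ is a matching $M$ in $Q_n$ such that every $k$-dimensional subcube of $Q_n$ contains both endpoints of at least one edge of $M$. *)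

theory Defs
  imports Main "HOL-Library.Disjoint_Sets"
begin

(* A vertex of the hypercube is a list of length n; True stands for 1, False for 0. *)

definition cube :: "nat \<Rightarrow> bool list set" where
  "cube n = {v. length v = n}"

definition cube_adj :: "nat \<Rightarrow> bool list \<Rightarrow> bool list \<Rightarrow> bool" where
  "cube_adj n u v \<longleftrightarrow> u \<in> cube n \<and> v \<in> cube n \<and> card {i. i < n \<and> u ! i \<noteq> v ! i} = 1"

definition cube_edges :: "nat \<Rightarrow> bool list set set" where
  "cube_edges n = {{u, v} | u v. cube_adj n u v}"

definition even_vertices :: "nat \<Rightarrow> bool list set" where
  "even_vertices n = {v \<in> cube n. even (count_list v True)}"

definition odd_vertices :: "nat \<Rightarrow> bool list set" where
  "odd_vertices n = {v \<in> cube n. odd (count_list v True)}"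

(* I is the set of fixed coordinates and a gives their values. The condition card I + d = n
   expresses card I = n - d without truncated subtraction, so there are no subcubes of
   dimension d > n. *)

definition subcubes :: "nat \<Rightarrow> nat \<Rightarrow> bool list set set" where
  "subcubes n d =
     {{v \<in> cube n. \<forall>i\<in>I. v ! i = a i} | I a. I \<subseteq> {..<n} \<and> card I + d = n}"

definition cube_matching :: "nat \<Rightarrow> bool list set set \<Rightarrow> bool" where
  "cube_matching n M \<longleftrightarrow> M \<subseteq> cube_edges n \<and> disjoint M"

definition breaker_pairing_strategy :: "nat \<Rightarrow> nat \<Rightarrow> bool list set set \<Rightarrow> bool" where
  "breaker_pairing_strategy n k M \<longleftrightarrow>
     cube_matching n M \<and> (\<forall>S\<in>subcubes n k. \<exists>e\<in>M. e \<subseteq> S)"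

end

theory Submission
  imports Defs
begin

text \<open>Split a vertex of \<open>Q\<^bsub>4n\<^esub>\<close> into four blocks in \<open>Q\<^sub>n\<close>. The parities of the blocks form a
  vertex of \<open>Q\<^sub>4\<close>, and a perfect matching of \<open>Q\<^sub>4\<close> decides in which block \<open>t\<close> the vertex is matched;
  there it is matched along \<open>V j\<close>, where \<open>j\<close> is the sum modulo \<open>m\<close> of the partition classes of
  the other three blocks. A subcube of dimension at least \<open>4k - 3\<close> has a block \<open>i\<close> of dimension
  at least \<open>k\<close>, where every \<open>V j\<close> has an edge, so it suffices to reach a parity vector matched
  in direction \<open>i\<close>. This fails only if exactly two blocks \<open>i\<close>, \<open>l\<close> are not fixed and the edge of
  \<open>Q\<^sub>4\<close> has direction \<open>l\<close>. If block \<open>l\<close> has dimension less than \<open>k\<close>, then block \<open>i\<close> has dimension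
  at least \<open>n - k + 2\<close>, so its class can be chosen to give any edge in block \<open>l\<close> the right \<open>j\<close>.\<close>

section \<open>Parity, edges and subcubes in a single hypercube\<close>

abbreviation even_weight :: "bool list \<Rightarrow> bool" where
  "even_weight v \<equiv> even (count_list v True)"

lemma even_weight_flip:
  assumes "i < length v"
  shows "even_weight (v[i := \<not> v ! i]) \<longleftrightarrow> \<not> even_weight v"
  using assms
proof (induction v arbitrary: i)
  case (Cons a v)
  then show ?case by (cases i) auto
qed simp

lemma cube_edges_cases:
  assumes "e \<in> cube_edges n"
  obtains u v where "e = {u, v}" "cube_adj n u v"
  using assms unfolding cube_edges_def by blast

lemma cube_adj_sym: "cube_adj n u v \<longleftrightarrow> cube_adj n v u"
  unfolding cube_adj_def by (auto simp: eq_commute)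

lemma pair_in_cube_edges_iff: "{u, v} \<in> cube_edges n \<longleftrightarrow> cube_adj n u v"
  unfolding cube_edges_def using cube_adj_sym by (auto simp: doubleton_eq_iff)

lemma cube_adj_flip:
  assumes "v \<in> cube n" "i < n"
  shows "cube_adj n v (v[i := \<not> v ! i])"
proof -
  have "{j. j < n \<and> v ! j \<noteq> v[i := \<not> v ! i] ! j} = {i}"
    using assms by (auto simp: cube_def nth_list_update)
  then show ?thesis
    using assms by (simp add: cube_adj_def cube_def)
qed

definition fixed_subcube :: "nat \<Rightarrow> nat set \<Rightarrow> (nat \<Rightarrow> bool) \<Rightarrow> bool list set" where
  "fixed_subcube n I a = {v \<in> cube n. \<forall>i\<in>I. v ! i = a i}"

lemma subcubes_iff:
  "S \<in> subcubes n d \<longleftrightarrow> (\<exists>I a. S = fixed_subcube n I a \<and> I \<subseteq> {..<n} \<and> card I + d = n)"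
  unfolding subcubes_def fixed_subcube_def by blast

lemma subcube_nonempty:
  assumes "S \<in> subcubes n d"
  shows "S \<noteq> {}"
proof -
  obtain I a where S: "S = fixed_subcube n I a" and "I \<subseteq> {..<n}"
    using assms subcubes_iff by auto
  then have "map a [0..<n] \<in> S"
    by (auto simp: fixed_subcube_def cube_def)
  then show ?thesis by blast
qed

text \<open>Fixing \<open>d - d'\<close> further coordinates, to the values that \<open>a\<close>
  already gives them, cuts out the smaller subcube.\<close>

lemma subcube_mono_dim:
  assumes "S \<in> subcubes n d" "d' \<le> d"
  obtains S' where "S' \<in> subcubes n d'" "S' \<subseteq> S"
proof -
  obtain I a where S: "S = fixed_subcube n I a" and I: "I \<subseteq> {..<n}" "card I + d = n"
    using assms(1) subcubes_iff by auto
  have "finite I" using I finite_subset by blast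
  have "card ({..<n} - I) = d"
    using I \<open>finite I\<close> by (simp add: card_Diff_subset)
  then obtain J where J: "J \<subseteq> {..<n} - I" "card J = d - d'"
    using obtain_subset_with_card_n[of "d - d'" "{..<n} - I"] by auto
  then have "finite J" by (meson finite_Diff finite_lessThan finite_subset)
  then have "card (I \<union> J) + d' = n"
    using I J \<open>finite I\<close> assms(2) by (subst card_Un_disjoint) auto
  then have "fixed_subcube n (I \<union> J) a \<in> subcubes n d'"
    using I J subcubes_iff by blast
  moreover have "fixed_subcube n (I \<union> J) a \<subseteq> S"
    unfolding S fixed_subcube_def by auto
  ultimately show thesis using that by blast
qed

text \<open>Positive dimension leaves a coordinate outside \<open>I\<close>, which can be flipped
  freely. This one flip yields both a vertex of each parity and an edge.\<close>

lemma subcube_free_coordinate: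
  assumes "S \<in> subcubes n d" "0 < d"
  obtains i where "i < n" "\<And>v. v \<in> S \<Longrightarrow> v[i := \<not> v ! i] \<in> S"
proof -
  obtain I a where S: "S = fixed_subcube n I a" and I: "I \<subseteq> {..<n}" "card I + d = n"
    using assms(1) subcubes_iff by auto
  have "I \<noteq> {..<n}"
  proof
    assume "I = {..<n}"
    then have "card I = n" by simp
    with I assms(2) show False by simp
  qed
  then obtain i where "i < n" "i \<notin> I" using I by auto
  moreover from this have "v[i := \<not> v ! i] \<in> S" if "v \<in> S" for v
    using that unfolding S fixed_subcube_def cube_def
    by (auto simp: nth_list_update)
  ultimately show thesis using that by blast
qed

lemma subcube_subset_cube: "S \<in> subcubes n d \<Longrightarrow> S \<subseteq> cube n"
  unfolding subcubes_def by blast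

lemma subcube_contains_parity:
  assumes "S \<in> subcubes n d" "0 < d"
  shows "\<exists>v\<in>S. even_weight v = p"
proof -
  obtain i where i: "i < n" "\<And>v. v \<in> S \<Longrightarrow> v[i := \<not> v ! i] \<in> S"
    using subcube_free_coordinate[OF assms] by blast
  obtain v where v: "v \<in> S" using subcube_nonempty[OF assms(1)] by blast
  then have "length v = n" using subcube_subset_cube[OF assms(1)] by (auto simp: cube_def)
  then show ?thesis
    using i v even_weight_flip[of i v] by metis
qed

lemma subcube_contains_edge:
  assumes "S \<in> subcubes n d" "0 < d"
  shows "\<exists>e\<in>cube_edges n. e \<subseteq> S"
proof -
  obtain i where i: "i < n" "\<And>v. v \<in> S \<Longrightarrow> v[i := \<not> v ! i] \<in> S"
    using subcube_free_coordinate[OF assms] by blast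
  obtain v where v: "v \<in> S" using subcube_nonempty[OF assms(1)] by blast
  then have "{v, v[i := \<not> v ! i]} \<in> cube_edges n"
    using i(1) subcube_subset_cube[OF assms(1)]
    by (auto simp: pair_in_cube_edges_iff intro!: cube_adj_flip)
  moreover have "{v, v[i := \<not> v ! i]} \<subseteq> S"
    using v i(2)[OF v] by simp
  ultimately show ?thesis by (rule bexI[rotated])
qed

lemma breaker_pairing_strategy_hits:
  assumes "breaker_pairing_strategy n k M" "S \<in> subcubes n d" "k \<le> d"
  shows "\<exists>e\<in>M. e \<subseteq> S"
  using assms subcube_mono_dim[OF assms(2,3)] unfolding breaker_pairing_strategy_def
  by (metis order_trans)

text \<open>Numbers the sets of the partition by the residues below \<open>m\<close>, so that
  classes can be added modulo \<open>m\<close>.\<close>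

lemma partition_class_function:
  assumes "partition_on X P" "card P = m" "0 < m"
  obtains c :: "'a \<Rightarrow> nat" where "\<And>j. j < m \<Longrightarrow> \<exists>A\<in>P. \<forall>v\<in>A. c v = j"
proof -
  have "finite P" using assms(2,3) card_ge_0_finite by blast
  then obtain f where f: "bij_betw f P {0..<m}"
    using assms(2) ex_bij_betw_finite_nat by blast
  have disj: "disjoint P" using assms(1) by (simp add: partition_on_def)
  define c where "c v = f (THE A. A \<in> P \<and> v \<in> A)" for v
  have c: "c v = f A" if "A \<in> P" "v \<in> A" for A v
  proof -
    have "(THE A. A \<in> P \<and> v \<in> A) = A"
      using that disj by (intro the_equality) (auto simp: disjoint_def)
    then show ?thesis by (simp add: c_def)
  qed
  have "\<exists>A\<in>P. \<forall>v\<in>A. c v = j" if "j < m" for j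
  proof -
    have "j \<in> f ` P" using f that by (simp add: bij_betw_def)
    then show ?thesis using c by blast
  qed
  then show thesis using that by blast
qed

section \<open>Splitting a vertex of the \<open>4 * n\<close>-cube into four blocks\<close>

definition block :: "nat \<Rightarrow> nat \<Rightarrow> bool list \<Rightarrow> bool list" where
  "block n t x = map (\<lambda>i. x ! (t * n + i)) [0..<n]"

text \<open>The inverse of taking blocks: \<open>w\<close> is total, but only its values at
  arguments below 4 matter.\<close>

definition join :: "nat \<Rightarrow> (nat \<Rightarrow> bool list) \<Rightarrow> bool list" where
  "join n w = map (\<lambda>i. w (i div n) ! (i mod n)) [0..<4 * n]"

definition set_block :: "nat \<Rightarrow> nat \<Rightarrow> bool list \<Rightarrow> bool list \<Rightarrow> bool list" where
  "set_block n t u x = join n ((\<lambda>h. block n h x)(t := u))"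

lemma block_in_cube [simp]: "block n t x \<in> cube n"
  by (simp add: block_def cube_def)

lemma join_in_cube [simp]: "join n w \<in> cube (4 * n)"
  by (simp add: join_def cube_def)

lemma set_block_in_cube [simp]: "set_block n t u x \<in> cube (4 * n)"
  by (simp add: set_block_def)

lemma block_index_less: "t < 4 \<Longrightarrow> i < n \<Longrightarrow> t * n + i < 4 * (n::nat)"
proof -
  assume "t < 4" "i < n"
  then have "Suc t * n \<le> 4 * n" by (intro mult_right_mono) auto
  with \<open>i < n\<close> show "t * n + i < 4 * n" unfolding mult_Suc by linarith
qed

lemma nth_join: "t < 4 \<Longrightarrow> i < n \<Longrightarrow> join n w ! (t * n + i) = w t ! i"
  using block_index_less[of t i n] by (simp add: join_def)

lemma block_join: "t < 4 \<Longrightarrow> w t \<in> cube n \<Longrightarrow> block n t (join n w) = w t"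
  by (auto simp: block_def nth_join cube_def intro!: nth_equalityI)

lemma block_set_block:
  "h < 4 \<Longrightarrow> u \<in> cube n \<Longrightarrow> block n h (set_block n t u x) = (if h = t then u else block n h x)"
  by (simp add: set_block_def block_join)

lemma nth_block_div_mod:
  assumes "i < 4 * n"
  shows "i div n < 4" "i mod n < n" "block n (i div n) x ! (i mod n) = x ! i"
proof -
  have "0 < n" using assms by (cases n) auto
  then show "i div n < 4" "i mod n < n"
    using assms by (auto simp: less_mult_imp_div_less)
  then show "block n (i div n) x ! (i mod n) = x ! i"
    by (simp add: block_def)
qed

lemma vertex_eqI:
  assumes "x \<in> cube (4 * n)" "y \<in> cube (4 * n)"
    and "\<And>h. h < 4 \<Longrightarrow> block n h x = block n h y"
  shows "x = y"
proof (rule nth_equalityI)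
  show "length x = length y" using assms by (simp add: cube_def)
  fix i assume "i < length x"
  then have "i < 4 * n" using assms(1) by (simp add: cube_def)
  then show "x ! i = y ! i"
    using nth_block_div_mod[of i n] assms(3) by metis
qed

text \<open>The coordinates where the two vertices differ are those where the two versions of block
  \<open>t\<close> differ, shifted by \<open>t * n\<close>.\<close>

lemma set_block_adj:
  assumes x: "x \<in> cube (4 * n)" and "t < 4" and adj: "cube_adj n (block n t x) u"
  shows "cube_adj (4 * n) x (set_block n t u x)"
proof -
  let ?y = "set_block n t u x"
  let ?J = "{i. i < n \<and> block n t x ! i \<noteq> u ! i}"
  have u: "u \<in> cube n" using adj by (simp add: cube_adj_def)
  have nth: "z ! (h * n + i) = block n h z ! i" if "i < n" for z h i
    using that by (simp add: block_def)
  have "{i. i < 4 * n \<and> x ! i \<noteq> ?y ! i} = (\<lambda>i. t * n + i) ` ?J"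
  proof (intro equalityI subsetI)
    fix i assume "i \<in> {i. i < 4 * n \<and> x ! i \<noteq> ?y ! i}"
    then have i: "i < 4 * n" "x ! i \<noteq> ?y ! i" by auto
    note dm = nth_block_div_mod[OF i(1)]
    have "block n (i div n) x ! (i mod n) \<noteq> block n (i div n) ?y ! (i mod n)"
      using dm(3) i(2) by simp
    then have "i div n = t" "i mod n \<in> ?J"
      using dm(1,2) u by (auto simp: block_set_block split: if_splits)
    moreover have "i = i div n * n + i mod n" by simp
    ultimately show "i \<in> (\<lambda>i. t * n + i) ` ?J" by blast
  next
    fix i assume "i \<in> (\<lambda>i. t * n + i) ` ?J"
    then obtain j where "i = t * n + j" "j < n" "block n t x ! j \<noteq> u ! j" by auto
    then show "i \<in> {i. i < 4 * n \<and> x ! i \<noteq> ?y ! i}"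
      using \<open>t < 4\<close> u block_index_less by (simp add: nth block_set_block)
  qed
  moreover have "card ((\<lambda>i. t * n + i) ` ?J) = 1"
    using adj by (subst card_image) (auto simp: cube_adj_def)
  ultimately show ?thesis
    using x by (simp add: cube_adj_def)
qed

text \<open>A subcube is a product of four subcubes of \<open>Q_n\<close>: the fixed set
  \<open>I\<close> is the disjoint union of the shifted sets \<open>J h\<close>, so the codimensions
  add up. For \<open>h\<close> at least 4 the set \<open>J h\<close> is empty and \<open>T h\<close>
  is the whole cube.\<close>

lemma subcube_blocks:
  assumes "S \<in> subcubes (4 * n) b"
  obtains T d where "\<And>h. T h \<in> subcubes n (d h)" "(\<Sum>h<4. d h) = b"
    "\<And>x. x \<in> cube (4 * n) \<Longrightarrow> (\<And>h. h < 4 \<Longrightarrow> block n h x \<in> T h) \<Longrightarrow> x \<in> S"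
proof -
  obtain I a where S: "S = fixed_subcube (4 * n) I a"
    and I: "I \<subseteq> {..<4 * n}" "card I + b = 4 * n"
    using assms subcubes_iff by auto
  define J where "J h = {i. i < n \<and> h * n + i \<in> I}" for h
  define T where "T h = fixed_subcube n (J h) (\<lambda>i. a (h * n + i))" for h
  define d where "d h = n - card (J h)" for h
  have J: "J h \<subseteq> {..<n}" for h by (auto simp: J_def)
  have cardJ: "card (J h) + d h = n" for h
    using card_mono[OF _ J[of h]] by (simp add: d_def)
  have "I = (\<Union>h<4. (\<lambda>i. h * n + i) ` J h)"
  proof (intro equalityI subsetI)
    fix i assume "i \<in> I"
    with I have "i < 4 * n" by auto
    note dm = nth_block_div_mod[OF this]
    have eq: "i = i div n * n + i mod n" by simp
    then have "i mod n \<in> J (i div n)" using dm \<open>i \<in> I\<close> by (simp add: J_def)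
    with eq dm(1) show "i \<in> (\<Union>h<4. (\<lambda>i. h * n + i) ` J h)" by blast
  qed (auto simp: J_def)
  moreover have "card (\<Union>h<4. (\<lambda>i. h * n + i) ` J h) = (\<Sum>h<4. card ((\<lambda>i. h * n + i) ` J h))"
  proof (rule card_UN_disjoint)
    show "\<forall>h\<in>{..<4}. finite ((\<lambda>i. h * n + i) ` J h)"
      using J finite_subset by blast
    \<comment> \<open>The shifts of different blocks are disjoint because division by
      \<open>n\<close> recovers the block number.\<close>
    have "h = h'" if "h * n + i = h' * n + i'" "i < n" "i' < n" for h h' i i'
    proof -
      have "(h * n + i) div n = h" "(h' * n + i') div n = h'"
        using that(2,3) by auto
      with that(1) show ?thesis by metis
    qed
    then show "\<forall>h\<in>{..<4}. \<forall>h'\<in>{..<4}. h \<noteq> h' \<longrightarrow>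
        (\<lambda>i. h * n + i) ` J h \<inter> (\<lambda>i. h' * n + i) ` J h' = {}"
      unfolding J_def by blast
  qed simp
  moreover have "card ((\<lambda>i. h * n + i) ` J h) = card (J h)" for h
    by (simp add: card_image)
  ultimately have "card I = (\<Sum>h<4. card (J h))" by simp
  moreover have "(\<Sum>h<4. card (J h)) + (\<Sum>h<4. d h) = 4 * n"
    using cardJ by (simp add: sum.distrib[symmetric])
  ultimately have "(\<Sum>h<4. d h) = b" using I by linarith
  moreover have "T h \<in> subcubes n (d h)" for h
    unfolding subcubes_iff T_def using J cardJ by blast
  moreover have "x \<in> S" if x: "x \<in> cube (4 * n)" "\<And>h. h < 4 \<Longrightarrow> block n h x \<in> T h" for x
  proof -
    have "x ! i = a i" if "i \<in> I" for i
    proof -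
      have "i < 4 * n" using that I by auto
      note dm = nth_block_div_mod[OF this]
      have "i mod n \<in> J (i div n)" using dm that by (simp add: J_def)
      then show ?thesis
        using x(2)[OF dm(1)] dm(3) by (auto simp: T_def fixed_subcube_def)
    qed
    with x(1) show ?thesis by (simp add: S fixed_subcube_def)
  qed
  ultimately show thesis using that by blast
qed

text \<open>The perfect matching of \<open>Q\<^sub>4\<close> with edges \<open>*100, *011, 0*10, 1*01, 10*0, 01*1, 000*, 111*\<close>:
  \<^term>\<open>parity_dir t p\<close> says that the edge at the vertex \<^term>\<open>p\<close> points in direction \<^term>\<open>t\<close>.
  Every two-dimensional face contains exactly one of its edges, and the two edges in each
  direction are antipodal, so each three-dimensional face contains an edge in each of its directions.\<close>

definition parity_dir :: "nat \<Rightarrow> (nat \<Rightarrow> bool) \<Rightarrow> bool" where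
  "parity_dir t p \<longleftrightarrow>
     (if t = 0 then p 1 \<noteq> p 2 \<and> p 2 = p 3
      else if t = 1 then p 0 \<noteq> p 2 \<and> p 0 = p 3
      else if t = 2 then p 0 \<noteq> p 1 \<and> p 1 = p 3
      else p 0 = p 1 \<and> p 1 = p 2)"

lemma less_4_iff: "(t::nat) < 4 \<longleftrightarrow> t = 0 \<or> t = 1 \<or> t = 2 \<or> t = 3"
  by auto

text \<open>Both ends of an edge in direction \<open>t\<close> carry that edge, so coordinate
  \<open>t\<close> of the parity vector is irrelevant.\<close>

lemma parity_dir_cong:
  assumes "\<And>h. h < 4 \<Longrightarrow> h \<noteq> t \<Longrightarrow> p h = q h" "t < 4"
  shows "parity_dir t p = parity_dir t q"
  using assms(2) assms(1)[of 0] assms(1)[of 1] assms(1)[of 2] assms(1)[of 3]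
  unfolding less_4_iff by (auto simp: parity_dir_def)

lemma parity_dir_unique:
  assumes "t < 4" "s < 4" "t \<noteq> s"
  shows "\<not> (parity_dir t p \<and> parity_dir s p)"
  using assms unfolding less_4_iff
  by (elim disjE) (simp_all add: parity_dir_def, blast+)

lemma parity_dir_face3:
  assumes "i < 4" "l < 4" "h < 4" "i \<noteq> l" "i \<noteq> h" "l \<noteq> h"
  shows "\<exists>b b'. parity_dir i (q(l := b, h := b'))"
  using assms unfolding less_4_iff
  by (elim disjE) (simp_all add: ex_bool_eq parity_dir_def)

lemma parity_dir_face2:
  assumes "i < 4" "l < 4" "i \<noteq> l"
  shows "\<exists>b b'. parity_dir i (q(i := b, l := b')) \<or> parity_dir l (q(i := b, l := b'))"
  using assms unfolding less_4_iff
  by (elim disjE) (simp_all add: ex_bool_eq parity_dir_def, blast+)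

section \<open>The matching of the \<open>4 * n\<close>-cube\<close>

definition other_class_sum :: "nat \<Rightarrow> (bool list \<Rightarrow> nat) \<Rightarrow> nat \<Rightarrow> bool list \<Rightarrow> nat" where
  "other_class_sum n c t x = (\<Sum>h\<in>{..<4} - {t}. c (block n h x))"

lemma other_class_sum_cong:
  assumes "\<And>h. h < 4 \<Longrightarrow> h \<noteq> t \<Longrightarrow> block n h x = block n h y"
  shows "other_class_sum n c t x = other_class_sum n c t y"
  unfolding other_class_sum_def using assms by (intro sum.cong) auto

definition product_pairs ::
  "nat \<Rightarrow> nat \<Rightarrow> (nat \<Rightarrow> bool list set set) \<Rightarrow> (bool list \<Rightarrow> nat) \<Rightarrow> bool list \<Rightarrow> nat \<Rightarrow> bool list \<Rightarrow> bool"
where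
  "product_pairs n m V c x t u \<longleftrightarrow> x \<in> cube (4 * n) \<and> t < 4 \<and>
     {block n t x, u} \<in> V (other_class_sum n c t x mod m) \<and>
     parity_dir t (\<lambda>h. even_weight (block n h x))"

definition product_matching ::
  "nat \<Rightarrow> nat \<Rightarrow> (nat \<Rightarrow> bool list set set) \<Rightarrow> (bool list \<Rightarrow> nat) \<Rightarrow> bool list set set"
where
  "product_matching n m V c = {{x, set_block n t u x} | x t u. product_pairs n m V c x t u}"

text \<open>Changing block \<open>t\<close> alone affects neither the class sum, which omits block
  \<open>t\<close>, nor direction \<open>t\<close> in the parity vector. Hence being matched is a
  symmetric relation.\<close>

lemma product_pairs_swap:
  assumes "product_pairs n m V c x t u" "u \<in> cube n"
  defines "y \<equiv> set_block n t u x"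
  shows "product_pairs n m V c y t (block n t x)" "set_block n t (block n t x) y = x"
proof -
  have t: "t < 4" and x: "x \<in> cube (4 * n)" using assms(1) by (auto simp: product_pairs_def)
  have blk: "block n h y = (if h = t then u else block n h x)" if "h < 4" for h
    using that assms(2) by (simp add: y_def block_set_block)
  have "other_class_sum n c t y = other_class_sum n c t x"
    using blk by (intro other_class_sum_cong) simp
  moreover have "parity_dir t (\<lambda>h. even_weight (block n h y)) =
      parity_dir t (\<lambda>h. even_weight (block n h x))"
    using blk t by (intro parity_dir_cong) simp_all
  ultimately show "product_pairs n m V c y t (block n t x)"
    using assms(1) blk[OF t] by (simp add: product_pairs_def insert_commute y_def)
  show "set_block n t (block n t x) y = x"
  proof (rule vertex_eqI)
    show "block n h (set_block n t (block n t x) y) = block n h x" if "h < 4" for h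
      using that blk by (simp add: block_set_block)
  qed (use x in simp_all)
qed

text \<open>By symmetry either end of a pair can serve as its base point, so two pairs that meet can
  be compared at the common vertex.\<close>

lemma product_matching_at_vertex:
  assumes V: "\<And>j. j < m \<Longrightarrow> V j \<subseteq> cube_edges n" and "0 < m"
    and "e \<in> product_matching n m V c" "x \<in> e"
  obtains t u where "product_pairs n m V c x t u" "e = {x, set_block n t u x}"
proof -
  obtain z t u where e: "e = {z, set_block n t u z}" and z: "product_pairs n m V c z t u"
    using assms(3) by (auto simp: product_matching_def)
  have "{block n t z, u} \<in> cube_edges n"
    using z V[of "other_class_sum n c t z mod m"] \<open>0 < m\<close> by (auto simp: product_pairs_def)
  then have u: "u \<in> cube n" by (simp add: pair_in_cube_edges_iff cube_adj_def)
  show thesis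
  proof (cases "x = z")
    case True
    then show ?thesis using that e z by blast
  next
    case False
    then have "x = set_block n t u z" using assms(4) e by auto
    then show ?thesis
      using that product_pairs_swap[OF z u] e by (metis insert_commute)
  qed
qed

text \<open>A vertex determines its partner in three stages: the parities give the block
  \<open>t\<close>, the other blocks give the index \<open>j\<close>, and disjointness of
  \<open>V j\<close> gives the new content of block \<open>t\<close>.\<close>

lemma product_matching_is_matching:
  assumes V: "\<And>j. j < m \<Longrightarrow> cube_matching n (V j)" and "0 < m"
  shows "cube_matching (4 * n) (product_matching n m V c)"
proof -
  have Vsub: "\<And>j. j < m \<Longrightarrow> V j \<subseteq> cube_edges n"
    using V by (simp add: cube_matching_def)
  have "e \<in> cube_edges (4 * n)" if e: "e \<in> product_matching n m V c" for e
  proof -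
    obtain x t u where e: "e = {x, set_block n t u x}" and x: "product_pairs n m V c x t u"
      using e by (auto simp: product_matching_def)
    have "{block n t x, u} \<in> cube_edges n"
      using x Vsub[of "other_class_sum n c t x mod m"] \<open>0 < m\<close> by (auto simp: product_pairs_def)
    then show ?thesis
      using x set_block_adj unfolding e
      by (simp add: pair_in_cube_edges_iff product_pairs_def)
  qed
  moreover have "e = e'" if e: "e \<in> product_matching n m V c"
    and e': "e' \<in> product_matching n m V c" and x: "x \<in> e" "x \<in> e'" for e e' x
  proof -
    obtain t u where tu: "product_pairs n m V c x t u" "e = {x, set_block n t u x}"
      using product_matching_at_vertex[where V = V, OF Vsub \<open>0 < m\<close> e x(1)] by blast
    obtain s v where sv: "product_pairs n m V c x s v" "e' = {x, set_block n s v x}"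
      using product_matching_at_vertex[where V = V, OF Vsub \<open>0 < m\<close> e' x(2)] by blast
    have "s = t" using tu(1) sv(1) parity_dir_unique[of s t] unfolding product_pairs_def by blast
    define j where "j = other_class_sum n c t x mod m"
    have "j < m" using \<open>0 < m\<close> by (simp add: j_def)
    have "{block n t x, u} \<in> V j" "{block n t x, v} \<in> V j"
      using tu(1) sv(1) \<open>s = t\<close> by (auto simp: product_pairs_def j_def)
    moreover have "disjoint (V j)" using V[OF \<open>j < m\<close>] by (simp add: cube_matching_def)
    ultimately have "{block n t x, u} = {block n t x, v}"
      by (meson disjointD disjoint_iff insertI1)
    then have "u = v" by (auto simp: doubleton_eq_iff)
    with \<open>s = t\<close> tu sv show ?thesis by simp
  qed
  ultimately show ?thesis
    unfolding cube_matching_def disjoint_def by blast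
qed

section \<open>Matched pairs inside subcubes\<close>

lemma product_matching_hits:
  assumes "t < 4" "\<And>h. h < 4 \<Longrightarrow> w h \<in> T h" "\<And>h. T h \<subseteq> cube n" "u \<in> T t"
    and "{w t, u} \<in> V ((\<Sum>h\<in>{..<4} - {t}. c (w h)) mod m)"
    and "parity_dir t p" "\<And>h. h < 4 \<Longrightarrow> h \<noteq> t \<Longrightarrow> even_weight (w h) = p h"
    and S: "\<And>x. x \<in> cube (4 * n) \<Longrightarrow> (\<And>h. h < 4 \<Longrightarrow> block n h x \<in> T h) \<Longrightarrow> x \<in> S"
  shows "\<exists>e\<in>product_matching n m V c. e \<subseteq> S"
proof -
  define x where "x = join n w"
  have x: "block n h x = w h" if "h < 4" for h
    using that assms(2,3) by (auto simp: x_def intro!: block_join)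
  have "u \<in> cube n" using assms(3,4) by blast
  have "x \<in> cube (4 * n)" by (simp add: x_def)
  have "other_class_sum n c t x = (\<Sum>h\<in>{..<4} - {t}. c (w h))"
    unfolding other_class_sum_def using x by (intro sum.cong) auto
  \<comment> \<open>The parity of \<open>w t\<close> is unconstrained, so block \<open>t\<close> may
    be either end of the edge chosen there.\<close>
  moreover have "parity_dir t (\<lambda>h. even_weight (block n h x)) = parity_dir t p"
    using assms(1,7) x by (intro parity_dir_cong) simp_all
  ultimately have "product_pairs n m V c x t u"
    using assms(1,5,6) x \<open>x \<in> cube (4 * n)\<close> by (simp add: product_pairs_def)
  then have "{x, set_block n t u x} \<in> product_matching n m V c"
    unfolding product_matching_def by blast
  moreover have "{x, set_block n t u x} \<subseteq> S"
    using S[OF \<open>x \<in> cube (4 * n)\<close>] S[of "set_block n t u x"] assms(2,4) x \<open>u \<in> cube n\<close>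
    by (simp add: block_set_block)
  ultimately show ?thesis by blast
qed

theorem theorem4:
  fixes n k m :: nat
    and V :: "nat \<Rightarrow> bool list set set"
    and P Q :: "bool list set set"
  assumes "0 < n" and "0 < k" and "0 < m"
    and "\<And>j. j < m \<Longrightarrow> breaker_pairing_strategy n k (V j)"
    and "(\<Union>j<m. V j) = cube_edges n"
    and "partition_on (even_vertices n) P" and "card P = m"
    and "partition_on (odd_vertices n) Q" and "card Q = m"
    and "\<And>d S A. d + k = n + 2 \<Longrightarrow> S \<in> subcubes n d \<Longrightarrow> A \<in> P \<union> Q \<Longrightarrow> S \<inter> A \<noteq> {}"
  shows "\<exists>M. breaker_pairing_strategy (4 * n) (max (4 * k - 3) (n + 1)) M"
proof -
  have Vm: "\<And>j. j < m \<Longrightarrow> cube_matching n (V j)"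
    using assms(4) by (simp add: breaker_pairing_strategy_def)
  obtain f where f: "\<And>j. j < m \<Longrightarrow> \<exists>A\<in>P. \<forall>v\<in>A. f v = j"
    using partition_class_function[OF assms(6,7,3)] by blast
  obtain g where g: "\<And>j. j < m \<Longrightarrow> \<exists>A\<in>Q. \<forall>v\<in>A. g v = j"
    using partition_class_function[OF assms(8,9,3)] by blast
  \<comment> \<open>One class function serves both partitions, because the parity of a vertex says
    which numbering applies.\<close>
  define c where "c v = (if even_weight v then f v else g v)" for v
  have P: "even_weight v" if "A \<in> P" "v \<in> A" for A v
    using that assms(6) by (auto simp: partition_on_def even_vertices_def)
  have Q: "\<not> even_weight v" if "A \<in> Q" "v \<in> A" for A v
    using that assms(8) by (auto simp: partition_on_def odd_vertices_def)
  \<comment> \<open>In so large a subcube, parity and class can be prescribed together: the set with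
    number \<open>j\<close> in the partition for the wanted parity meets it.\<close>
  have classes: "\<exists>v\<in>S. even_weight v = p \<and> c v = j"
    if S: "S \<in> subcubes n d" and d: "n + 2 \<le> d + k" and k: "k \<le> n" and j: "j < m" for S d p j
  proof -
    obtain S' where S': "S' \<in> subcubes n (n + 2 - k)" "S' \<subseteq> S"
    proof (rule subcube_mono_dim[OF S])
      show "n + 2 - k \<le> d" using d by simp
    qed
    have hit: "S' \<inter> A \<noteq> {}" if "A \<in> P \<union> Q" for A
      using assms(10)[of "n + 2 - k" S' A] S' k that by simp
    obtain A where A: "A \<in> P \<union> Q" "\<forall>v\<in>A. even_weight v = p \<and> c v = j"
    proof (cases p)
      case True
      obtain A where "A \<in> P" "\<forall>v\<in>A. f v = j" using f j by blast
      with P True that[of A] show ?thesis by (simp add: c_def)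
    next
      case False
      obtain A where "A \<in> Q" "\<forall>v\<in>A. g v = j" using g j by blast
      with Q False that[of A] show ?thesis by (simp add: c_def)
    qed
    with hit[of A] S' show ?thesis by blast
  qed
  have "\<exists>e\<in>product_matching n m V c. e \<subseteq> S"
    if "S \<in> subcubes (4 * n) (max (4 * k - 3) (n + 1))" for S
  proof -
    obtain T d where T: "\<And>h. T h \<in> subcubes n (d h)"
      and d: "(\<Sum>h<4. d h) = max (4 * k - 3) (n + 1)"
      and TS: "\<And>x. x \<in> cube (4 * n) \<Longrightarrow> (\<And>h. h < 4 \<Longrightarrow> block n h x \<in> T h) \<Longrightarrow> x \<in> S"
      using subcube_blocks[OF \<open>S \<in> _\<close>] by metis
    have Tc: "T h \<subseteq> cube n" for h using T subcube_subset_cube by blast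
    have dn: "d h \<le> n" for h
      using T[of h] by (auto simp: subcubes_def)
    have "\<forall>h. \<exists>v. v \<in> T h" using subcube_nonempty[OF T] by blast
    then obtain v0 where v0: "\<And>h. v0 h \<in> T h" by metis
    \<comment> \<open>A block of dimension 0 is a single vertex, so its parity is forced to be
      \<open>q h\<close>; the parities of all other blocks are free.\<close>
    define q where "q h = even_weight (v0 h)" for h
    have pars: "\<exists>w. \<forall>h. w h \<in> T h \<and> even_weight (w h) = p h"
      if "\<And>h. d h = 0 \<Longrightarrow> p h = q h" for p
    proof -
      have "\<exists>v. v \<in> T h \<and> even_weight v = p h" for h
        using that[of h] v0[of h] subcube_contains_parity[OF T[of h]]
        by (cases "d h = 0") (auto simp: q_def)
      then show ?thesis by metis
    qed
    \<comment> \<open>If the parity vector points to a block \<open>t\<close> of dimension at least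
      \<open>k\<close>, the other blocks are chosen first. They determine \<open>j\<close>, and
      \<open>V j\<close> has an edge inside \<open>T t\<close> whatever \<open>j\<close> is.\<close>
    have long: ?thesis
      if t: "t < 4" "k \<le> d t" "parity_dir t p" and p: "\<And>h. d h = 0 \<Longrightarrow> p h = q h" for t p
    proof -
      obtain w where w: "\<And>h. w h \<in> T h" "\<And>h. even_weight (w h) = p h"
        using pars[OF p] by blast
      define j where "j = (\<Sum>h\<in>{..<4} - {t}. c (w h)) mod m"
      have "j < m" using assms(3) by (simp add: j_def)
      obtain e where e: "e \<in> V j" "e \<subseteq> T t"
        using breaker_pairing_strategy_hits[OF assms(4)[OF \<open>j < m\<close>] T t(2)] by blast
      have "e \<in> cube_edges n" using e(1) assms(5) \<open>j < m\<close> by blast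
      then obtain y u where yu: "e = {y, u}" using cube_edges_cases by metis
      have "(\<Sum>h\<in>{..<4} - {t}. c ((w(t := y)) h)) = (\<Sum>h\<in>{..<4} - {t}. c (w h))"
        by (intro sum.cong) auto
      then have "{(w(t := y)) t, u} \<in> V ((\<Sum>h\<in>{..<4} - {t}. c ((w(t := y)) h)) mod m)"
        using e(1) yu by (simp add: j_def)
      then show ?thesis
        using w e yu t TS Tc
        by (intro product_matching_hits[where w = "w(t := y)" and T = T and t = t and u = u and p = p])
          auto
    qed
    \<comment> \<open>Otherwise the dimensions would sum to at most
      \<open>4 * k - 4\<close>.\<close>
    have "\<exists>i<4. k \<le> d i"
    proof (rule ccontr)
      assume "\<not> ?thesis"
      then have "(\<Sum>h<4. d h) \<le> (\<Sum>h<(4::nat). k - 1)" by (intro sum_mono) auto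
      then have "4 * k - 3 \<le> 4 * (k - 1)" unfolding d by simp
      then show False using assms(2) by linarith
    qed
    then obtain i where i: "i < 4" "k \<le> d i" by blast
    have "k \<le> n" using i dn[of i] by simp
    have "(\<Sum>h<4. d h) = d i + (\<Sum>h\<in>{..<4} - {i}. d h)"
      using i by (intro sum.remove) auto
    \<comment> \<open>The total is at least \<open>n + 1\<close>, more than block \<open>i\<close>
      alone can supply, so a second block is not fixed.\<close>
    then have "(\<Sum>h\<in>{..<4} - {i}. d h) \<noteq> 0"
      using d dn[of i] by linarith
    then obtain l where l: "l < 4" "l \<noteq> i" "d l \<noteq> 0" by auto
    show ?thesis
    \<comment> \<open>With a third free block, the parities of \<open>l\<close> and \<open>h\<close>
      can be set to make the edge point in direction \<open>i\<close>.\<close>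
    proof (cases "\<exists>h<4. h \<noteq> i \<and> h \<noteq> l \<and> d h \<noteq> 0")
      case True
      then obtain h where h: "h < 4" "h \<noteq> i" "h \<noteq> l" "d h \<noteq> 0" by blast
      then obtain b b' where "parity_dir i (q(l := b, h := b'))"
        using parity_dir_face3[of i l h q] i l by blast
      then show ?thesis by (rule long[OF i]) (use l h in auto)
    next
      case False
      obtain b b' where "parity_dir i (q(i := b, l := b')) \<or> parity_dir l (q(i := b, l := b'))"
        using parity_dir_face2[of i l q] i l by blast
      moreover define p where "p = q(i := b, l := b')"
      ultimately have dir: "parity_dir i p \<or> parity_dir l p" by simp
      have p: "\<And>h. d h = 0 \<Longrightarrow> p h = q h"
        using i l assms(2) by (auto simp: p_def)
      show ?thesis
      \<comment> \<open>If the edge points in direction \<open>l\<close> but block \<open>l\<close>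
        is long as well, \<open>l\<close> simply takes over the role of \<open>i\<close>.\<close>
      proof (cases "parity_dir i p \<or> k \<le> d l")
        case True
        then show ?thesis using dir long[of i p] long[of l p] i l p by blast
      next
        case short: False
        with dir have "parity_dir l p" by blast
        have "(\<Sum>h\<in>{..<4} - {i}. d h) = d l + (\<Sum>h\<in>{..<4} - {i} - {l}. d h)"
          using l by (intro sum.remove) auto
        moreover have "(\<Sum>h\<in>{..<4} - {i} - {l}. d h) = 0" using False by auto
        ultimately have "n + 1 \<le> d i + d l"
          using d \<open>(\<Sum>h<4. d h) = d i + _\<close> by linarith
        then have "n + 2 \<le> d i + k" using short by linarith
        \<comment> \<open>Here the order is reversed: any edge in block \<open>l\<close> is taken
          first, it lies in some \<open>V j\<close> because these cover all edges, and block
          \<open>i\<close> is then adjusted to produce this \<open>j\<close>.\<close>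
        obtain e where e: "e \<in> cube_edges n" "e \<subseteq> T l"
          using subcube_contains_edge[OF T] l by blast
        obtain y u where yu: "e = {y, u}" using e(1) cube_edges_cases by metis
        obtain j where j: "j < m" "e \<in> V j" using e(1) assms(5) by blast
        obtain w where w: "\<And>h. w h \<in> T h" "\<And>h. even_weight (w h) = p h"
          using pars[OF p] by blast
        define r where "r = (\<Sum>h\<in>{..<4} - {l} - {i}. c (w h))"
        \<comment> \<open>The class needed in block \<open>i\<close>, that is \<open>j - r\<close>
          modulo \<open>m\<close>; subtracting \<open>r mod m\<close> from \<open>m\<close> keeps
          the natural subtraction exact.\<close>
        define s where "s = (j + (m - r mod m)) mod m"
        have "s < m" using assms(3) by (simp add: s_def)
        have "(s + r) mod m = j"
        proof -
          have "(s + r) mod m = (j + (m - r mod m) + r mod m) mod m"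
            by (simp add: s_def mod_simps)
          also have "j + (m - r mod m) + r mod m = j + m"
            using mod_less_divisor[OF assms(3), of r] by linarith
          finally show ?thesis using j(1) by simp
        qed
        obtain v where v: "v \<in> T i" "even_weight v = p i" "c v = s"
          using classes[OF T \<open>n + 2 \<le> d i + k\<close> \<open>k \<le> n\<close> \<open>s < m\<close>] by blast
        let ?w = "w(i := v, l := y)"
        have "(\<Sum>h\<in>{..<4} - {l}. c (?w h)) = c (?w i) + (\<Sum>h\<in>{..<4} - {l} - {i}. c (?w h))"
          using i l by (intro sum.remove) auto
        also have "(\<Sum>h\<in>{..<4} - {l} - {i}. c (?w h)) = r"
          unfolding r_def by (intro sum.cong) auto
        finally have "(\<Sum>h\<in>{..<4} - {l}. c (?w h)) mod m = j"
          using l v \<open>(s + r) mod m = j\<close> by simp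
        then have "{?w l, u} \<in> V ((\<Sum>h\<in>{..<4} - {l}. c (?w h)) mod m)"
          using j yu by simp
        then show ?thesis
          using w v e yu l \<open>parity_dir l p\<close> TS Tc
          by (intro product_matching_hits[where w = ?w and T = T and t = l and u = u and p = p])
            auto
      qed
    qed
  qed
  then have "breaker_pairing_strategy (4 * n) (max (4 * k - 3) (n + 1)) (product_matching n m V c)"
    using product_matching_is_matching[of m n V c, OF Vm assms(3)]
    by (simp add: breaker_pairing_strategy_def)
  then show ?thesis by blast
qed

end
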